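(* The lattice of subTuring degrees is not modular; that is, there exist subTuring degrees $\mathbf{a},\mathbf{b},\mathbf{c}$ with $\mathbf{a}\leq\mathbf{b}$ and $\mathbf{a}\vee(\mathbf{b}\wedge\mathbf{c})\neq\mathbf{b}\wedge(\mathbf{a}\vee\mathbf{c})$.
   Context: For a partial computable function $\Phi$ from finite sequences of natural numbers to $\{0,1\}\times\omega$ and a partial function $g\colon\subseteq\omega\to\omega$, the $g$-relative sequential computation $\Phi[g]$ is defined as follows. On input $n$, with oracle answers $a_0,\dots,a_{s-1}$ obtained so far: if $\Phi(n,a_0,\dots,a_{s-1})$ is undefined, $\Phi[g](n)$ is undefined; if it equals $\langle 1,q\rangle$ the computation halts with output $q$; if it equals $\langle 0,q\rangle$, $q$ is a query, and if $q\in{\rm dom}(g)$ the computation continues with $a_s=g(q)$, while if $q\notin{\rm dom}(g)$ the computation never halts. $\Phi_e$ is the $e$-th such partial computable function. $f\leq_{\rm subT} g$ means $f\subseteq\Phi_e[g]$ for some $e$; subTuring degrees are $\equiv_{\rm subT}$-classes ordered by $\leq_{\rm subT}$. The join $\vee$ is induced by $(f\oplus g)(2n)=f(n)$, $(f\oplus g)(2n+1)=g(n)$, and the meet $\wedge$ by $(f\cap g)(\langle d,e,n\rangle)=\Phi_d[f](n)$ if $\Phi_d[f](n)$ and $\Phi_e[g](n)$ are both defined and equal, undefined otherwise. *)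

theory Defs
  imports Complex_Main "HOL-Library.Nat_Bijection"
begin

text \<open>
  Partial recursive functions in unary form: tuples of arguments are coded by the Cantor pairing
  \<^const>\<open>prod_encode\<close>. \<open>Prec f g\<close> is primitive recursion with parameter \<open>a\<close> on coded
  arguments \<open>(a, n)\<close>; \<open>Mn f\<close> maps \<open>a\<close> to the least \<open>n\<close> with \<open>f (a, n) = 0\<close>, provided that
  \<open>f (a, m)\<close> is defined for all \<open>m < n\<close>.
\<close>

datatype recf =
    Zero
  | Succ
  | Fst
  | Snd
  | Pairing recf recf
  | Comp recf recf
  | Prec recf recf
  | Mn recf

primrec eval :: "recf \<Rightarrow> nat \<rightharpoonup> nat" where
  "eval Zero = (\<lambda>x. Some 0)"
| "eval Succ = (\<lambda>x. Some (Suc x))"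
| "eval Fst = (\<lambda>x. Some (fst (prod_decode x)))"
| "eval Snd = (\<lambda>x. Some (snd (prod_decode x)))"
| "eval (Pairing f g) =
     (\<lambda>x. Option.bind (eval f x) (\<lambda>y. Option.bind (eval g x) (\<lambda>z. Some (prod_encode (y, z)))))"
| "eval (Comp f g) = eval f \<circ>\<^sub>m eval g"
| "eval (Prec f g) =
     (\<lambda>x. case prod_decode x of (a, n) \<Rightarrow>
        rec_nat (eval f a)
          (\<lambda>m r. Option.bind r (\<lambda>y. eval g (prod_encode (a, prod_encode (m, y))))) n)"
| "eval (Mn f) =
     (\<lambda>a. let P = (\<lambda>n. eval f (prod_encode (a, n)) = Some 0 \<and>
                       (\<forall>m<n. eval f (prod_encode (a, m)) \<noteq> None))
          in if \<exists>n. P n then Some (LEAST n. P n) else None)"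

text \<open>
  The numbering has to be effective, and not merely surjective, since indices occur as arguments
  in the definition of the meet below.
\<close>

fun recf_index :: "recf \<Rightarrow> nat" where
  "recf_index Zero = 0"
| "recf_index Succ = 1"
| "recf_index Fst = 2"
| "recf_index Snd = 3"
| "recf_index (Pairing f g) = 4 + 4 * prod_encode (recf_index f, recf_index g)"
| "recf_index (Comp f g) = 5 + 4 * prod_encode (recf_index f, recf_index g)"
| "recf_index (Prec f g) = 6 + 4 * prod_encode (recf_index f, recf_index g)"
| "recf_index (Mn f) = 7 + 4 * recf_index f"

lemma prod_decode_le:
  "fst (prod_decode k) \<le> k" "snd (prod_decode k) \<le> k"
  by (metis le_prod_encode_1 prod.collapse prod_decode_inverse)
     (metis le_prod_encode_2 prod.collapse prod_decode_inverse)

function recf_of :: "nat \<Rightarrow> recf" where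
  "recf_of e =
     (if e = 0 then Zero
      else if e = 1 then Succ
      else if e = 2 then Fst
      else if e = 3 then Snd
      else
        let k = (e - 4) div 4;
            i = fst (prod_decode k);
            j = snd (prod_decode k)
        in if e mod 4 = 0 then Pairing (recf_of i) (recf_of j)
           else if e mod 4 = 1 then Comp (recf_of i) (recf_of j)
           else if e mod 4 = 2 then Prec (recf_of i) (recf_of j)
           else Mn (recf_of k))"
  by pat_completeness auto
termination
proof (relation "measure (\<lambda>e. e)", goal_cases)
qed (auto intro: le_less_trans[OF prod_decode_le(1)] le_less_trans[OF prod_decode_le(2)])

declare recf_of.simps [simp del]

lemma recf_of_index: "recf_of (recf_index c) = c"
proof (induction c)
  case (Pairing f g)
  then show ?case by (subst recf_of.simps) (simp add: Let_def mod_simps)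
next
  case (Comp f g)
  have "(5 + 4 * k) mod 4 = (1::nat)" "(1 + 4 * k) div 4 = k" for k :: nat by presburger+
  with Comp show ?case by (subst recf_of.simps) (simp add: Let_def)
next
  case (Prec f g)
  have "(6 + 4 * k) mod 4 = (2::nat)" "(2 + 4 * k) div 4 = k" for k :: nat by presburger+
  with Prec show ?case by (subst recf_of.simps) (simp add: Let_def)
next
  case (Mn f)
  have "(7 + 4 * k) mod 4 = (3::nat)" "(3 + 4 * k) div 4 = k" for k :: nat by presburger+
  with Mn show ?case by (subst recf_of.simps) (simp add: Let_def)
qed (simp_all add: recf_of.simps)

text \<open>
  \<open>\<Phi>\<^sub>e\<close>, as a partial function from finite sequences to \<open>{0,1} \<times> \<omega>\<close>. Values are coded by
  the bijection \<open>(i, q) \<mapsto> 2 * q + i\<close>, so that every index yields a function of this kind.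
\<close>

definition Phi :: "nat \<Rightarrow> nat list \<rightharpoonup> nat \<times> nat" where
  "Phi e \<sigma> = map_option (\<lambda>y. (y mod 2, y div 2)) (eval (recf_of e) (list_encode \<sigma>))"

text \<open>\<^const>\<open>None\<close> results also from an infinite sequence of queries (least fixed point).\<close>

partial_function (option) run ::
    "(nat list \<rightharpoonup> nat \<times> nat) \<Rightarrow> (nat \<rightharpoonup> nat) \<Rightarrow> nat list \<Rightarrow> nat option" where
  "run F g \<sigma> =
     Option.bind (F \<sigma>) (\<lambda>(i, q).
       if i = 1 then Some q
       else Option.bind (g q) (\<lambda>a. run F g (\<sigma> @ [a])))"

definition seq_comp :: "(nat list \<rightharpoonup> nat \<times> nat) \<Rightarrow> (nat \<rightharpoonup> nat) \<Rightarrow> nat \<rightharpoonup> nat" where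
  "seq_comp F g n = run F g [n]"

definition subT_le :: "(nat \<rightharpoonup> nat) \<Rightarrow> (nat \<rightharpoonup> nat) \<Rightarrow> bool" (infix "\<le>\<^sub>s\<^sub>u\<^sub>b\<^sub>T" 50) where
  "f \<le>\<^sub>s\<^sub>u\<^sub>b\<^sub>T g \<longleftrightarrow> (\<exists>e. f \<subseteq>\<^sub>m seq_comp (Phi e) g)"

definition subT_join :: "(nat \<rightharpoonup> nat) \<Rightarrow> (nat \<rightharpoonup> nat) \<Rightarrow> (nat \<rightharpoonup> nat)" where
  "subT_join f g k = (if even k then f (k div 2) else g (k div 2))"

definition subT_meet :: "(nat \<rightharpoonup> nat) \<Rightarrow> (nat \<rightharpoonup> nat) \<Rightarrow> (nat \<rightharpoonup> nat)" where
  "subT_meet f g k =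
     (let d = fst (prod_decode k);
          e = fst (prod_decode (snd (prod_decode k)));
          n = snd (prod_decode (snd (prod_decode k)))
      in if seq_comp (Phi d) f n = seq_comp (Phi e) g n then seq_comp (Phi d) f n else None)"

definition subT_equiv :: "((nat \<rightharpoonup> nat) \<times> (nat \<rightharpoonup> nat)) set" where
  "subT_equiv = {(f, g). f \<le>\<^sub>s\<^sub>u\<^sub>b\<^sub>T g \<and> g \<le>\<^sub>s\<^sub>u\<^sub>b\<^sub>T f}"

definition subT_degrees :: "(nat \<rightharpoonup> nat) set set" where
  "subT_degrees = UNIV // subT_equiv"

text \<open>
  Order and operations induced on the equivalence classes. They are independent of the choice of
  representatives, so the unions below are again single classes.
\<close>

definition degree_le :: "(nat \<rightharpoonup> nat) set \<Rightarrow> (nat \<rightharpoonup> nat) set \<Rightarrow> bool" where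
  "degree_le a b \<longleftrightarrow> (\<exists>f\<in>a. \<exists>g\<in>b. f \<le>\<^sub>s\<^sub>u\<^sub>b\<^sub>T g)"

definition degree_join :: "(nat \<rightharpoonup> nat) set \<Rightarrow> (nat \<rightharpoonup> nat) set \<Rightarrow> (nat \<rightharpoonup> nat) set" where
  "degree_join a b = (\<Union>f\<in>a. \<Union>g\<in>b. subT_equiv `` {subT_join f g})"

definition degree_meet :: "(nat \<rightharpoonup> nat) set \<Rightarrow> (nat \<rightharpoonup> nat) set \<Rightarrow> (nat \<rightharpoonup> nat) set" where
  "degree_meet a b = (\<Union>f\<in>a. \<Union>g\<in>b. subT_equiv `` {subT_meet f g})"

end

theory Submission
  imports Defs "HOL-Library.Countable"
begin

text \<open>
  The partial functions \<open>b\<close> and \<open>c\<close> consist of infinitely many blocks \<open>(d, s, r, x)\<close> with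
  \<open>c d = s\<close>, \<open>b s = r\<close>, \<open>c r = x\<close> and \<open>b d = x\<close>, where the \<open>s\<close> are even and the \<open>d\<close> are odd;
  \<open>a\<close> is the restriction of \<open>b\<close> to even arguments. The map \<open>d \<mapsto> x\<close> is below \<open>b\<close>, and below
  \<open>a \<or> c\<close> by querying \<open>c\<close>, \<open>a\<close>, \<open>c\<close> alternately. It is not below \<open>a \<or> (b \<and> c)\<close>: given only \<open>d\<close>,
  \<open>b\<close> yields \<open>x\<close> but not \<open>s\<close>, whereas \<open>c\<close> yields \<open>s\<close> but not \<open>x\<close>, so their common part
  yields neither, and without \<open>s\<close> the function \<open>a\<close> is of no use.

  The blocks are chosen one by one, the \<open>n\<close>-th one defeating the \<open>n\<close>-th potential reduction.
  That a value is undefined is preserved by keeping a single query unanswered forever, so each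
  block imposes only finitely many restrictions on the later ones.
\<close>

section \<open>Sequential operators\<close>

text \<open>
  If \<open>T\<close> is undefined at an oracle but can be made defined by extending it, then a single query
  \<open>q\<close> has to be answered first. Unlike continuity, this implies stability.
\<close>

definition seq_op :: "(('q \<rightharpoonup> 'r) \<Rightarrow> 'v option) \<Rightarrow> bool" where
  "seq_op T \<longleftrightarrow>
     (\<forall>u u' v. u \<subseteq>\<^sub>m u' \<longrightarrow> T u = Some v \<longrightarrow> T u' = Some v) \<and>
     (\<forall>u u'. u \<subseteq>\<^sub>m u' \<longrightarrow> T u = None \<longrightarrow> T u' \<noteq> None \<longrightarrow>
        (\<exists>q. u q = None \<and> (\<forall>u''. u \<subseteq>\<^sub>m u'' \<longrightarrow> u'' q = None \<longrightarrow> T u'' = None)))"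

lemma seq_op_mono: "seq_op T \<Longrightarrow> u \<subseteq>\<^sub>m u' \<Longrightarrow> T u = Some v \<Longrightarrow> T u' = Some v"
  unfolding seq_op_def by blast

lemma seq_op_stuck:
  assumes "seq_op T" "u \<subseteq>\<^sub>m u'" "T u = None" "T u' \<noteq> None"
  obtains q where "u q = None" "\<And>u''. u \<subseteq>\<^sub>m u'' \<Longrightarrow> u'' q = None \<Longrightarrow> T u'' = None"
  using assms unfolding seq_op_def by blast

lemma map_le_Some: "f \<subseteq>\<^sub>m g \<Longrightarrow> f x = Some y \<Longrightarrow> g x = Some y"
  by (metis domI map_le_def)

lemma map_leI: "(\<And>x y. f x = Some y \<Longrightarrow> g x = Some y) \<Longrightarrow> f \<subseteq>\<^sub>m g"
  by (fastforce simp: map_le_def)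

lemma seq_op_const: "seq_op (\<lambda>u. v)"
  by (auto simp: seq_op_def)

lemma seq_op_query: "seq_op (\<lambda>u. u q)"
  by (auto simp: seq_op_def dest: map_le_Some)

text \<open>If the common part left \<open>T\<close> undefined, the blocking query would have to be
  answered by both \<open>u\<^sub>1\<close> and \<open>u\<^sub>2\<close>. Inside \<open>w\<close>
  the two answers coincide, so the common part contains the answer as well.\<close>

lemma seq_op_stable:
  assumes T: "seq_op T" and le: "u\<^sub>1 \<subseteq>\<^sub>m w" "u\<^sub>2 \<subseteq>\<^sub>m w"
    and v: "T u\<^sub>1 = Some v" "T u\<^sub>2 = Some v'"
  shows "T (\<lambda>q. if u\<^sub>1 q = u\<^sub>2 q then u\<^sub>1 q else None) = Some v"
proof -
  let ?m = "\<lambda>q. if u\<^sub>1 q = u\<^sub>2 q then u\<^sub>1 q else None"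
  have m1: "?m \<subseteq>\<^sub>m u\<^sub>1" by (rule map_leI) (auto split: if_splits)
  have m2: "?m \<subseteq>\<^sub>m u\<^sub>2" by (rule map_leI) (auto split: if_splits)
  have "T ?m \<noteq> None"
  proof
    assume "T ?m = None"
    with v(1) obtain q where q: "?m q = None"
        "\<And>u''. ?m \<subseteq>\<^sub>m u'' \<Longrightarrow> u'' q = None \<Longrightarrow> T u'' = None"
      by (blast intro: seq_op_stuck[OF T m1])
    have "u\<^sub>1 q \<noteq> None" "u\<^sub>2 q \<noteq> None"
      using q(2)[OF m1] q(2)[OF m2] v by auto
    with le have "u\<^sub>1 q = w q" "u\<^sub>2 q = w q"
      by (auto simp: map_le_def)
    with q(1) \<open>u\<^sub>1 q \<noteq> None\<close> show False by auto
  qed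
  then show ?thesis
    using seq_op_mono[OF T m1] v(1) by fastforce
qed

text \<open>A wrong value persists by monotonicity, and undefinedness persists while the blocking
  query is unanswered; so \<open>S\<close> is empty or a singleton.\<close>

lemma seq_op_avoid:
  assumes T: "seq_op T" and neq: "T u \<noteq> Some v"
  shows "\<exists>S. finite S \<and> S \<inter> dom u = {} \<and>
    (\<forall>u'. u \<subseteq>\<^sub>m u' \<longrightarrow> S \<inter> dom u' = {} \<longrightarrow> T u' \<noteq> Some v)"
proof (cases "\<forall>u'. u \<subseteq>\<^sub>m u' \<longrightarrow> T u' \<noteq> Some v")
  case True
  then show ?thesis by (intro exI[of _ "{}"]) auto
next
  case False
  then obtain w where w: "u \<subseteq>\<^sub>m w" "T w = Some v" by auto
  with neq have "T u = None"
    using seq_op_mono[OF T w(1)] by (cases "T u") auto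
  with w obtain q where "u q = None" "\<And>u''. u \<subseteq>\<^sub>m u'' \<Longrightarrow> u'' q = None \<Longrightarrow> T u'' = None"
    by (auto intro: seq_op_stuck[OF T w(1)])
  then show ?thesis by (intro exI[of _ "{q}"]) fastforce
qed

text \<open>If both sides were defined at \<open>u\<close>, agreement at \<open>u'\<close> would
  force agreement at \<open>u\<close>. Hence one side is undefined at \<open>u\<close>, and its
  blocking query blocks the comparison too.\<close>

lemma seq_op_agree:
  assumes A: "seq_op A" and B: "seq_op B"
  shows "seq_op (\<lambda>u. if A u = B u then A u else None)"
  unfolding seq_op_def
proof (intro conjI allI impI)
  fix u u' v
  assume "u \<subseteq>\<^sub>m u'" "(if A u = B u then A u else None) = Some v"
  then show "(if A u' = B u' then A u' else None) = Some v"
    using seq_op_mono[OF A] seq_op_mono[OF B] by (metis option.distinct(1))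
next
  fix u u'
  assume le: "u \<subseteq>\<^sub>m u'" and N: "(if A u = B u then A u else None) = None"
    and D: "(if A u' = B u' then A u' else None) \<noteq> None"
  have D': "A u' \<noteq> None" "B u' \<noteq> None" "A u' = B u'" using D by (auto split: if_splits)
  have "A u = None \<or> B u = None"
  proof (rule ccontr)
    assume "\<not> ?thesis"
    then obtain v w where "A u = Some v" "B u = Some w" by auto
    with seq_op_mono[OF A le] seq_op_mono[OF B le] N D' show False by (auto split: if_splits)
  qed
  then show "\<exists>q. u q = None \<and> (\<forall>u''. u \<subseteq>\<^sub>m u'' \<longrightarrow> u'' q = None \<longrightarrow>
      (if A u'' = B u'' then A u'' else None) = None)"
  proof
    assume "A u = None"
    then obtain q where "u q = None" "\<And>u''. u \<subseteq>\<^sub>m u'' \<Longrightarrow> u'' q = None \<Longrightarrow> A u'' = None"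
      by (blast intro: seq_op_stuck[OF A, OF le _ D'(1)])
    then show ?thesis by (intro exI[of _ q]) auto
  next
    assume "B u = None"
    then obtain q where "u q = None" "\<And>u''. u \<subseteq>\<^sub>m u'' \<Longrightarrow> u'' q = None \<Longrightarrow> B u'' = None"
      by (blast intro: seq_op_stuck[OF B, OF le _ D'(2)])
    then show ?thesis by (intro exI[of _ q]) auto
  qed
qed

section \<open>Relative computations as sequential operators\<close>

lemma run_Some_induct [consumes 1, case_names Halt Query]:
  assumes "run F g \<sigma> = Some v"
    and "\<And>\<sigma> q. F \<sigma> = Some (1, q) \<Longrightarrow> P \<sigma> q"
    and "\<And>\<sigma> i q a v. F \<sigma> = Some (i, q) \<Longrightarrow> i \<noteq> 1 \<Longrightarrow> g q = Some a \<Longrightarrow>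
           run F g (\<sigma> @ [a]) = Some v \<Longrightarrow> P (\<sigma> @ [a]) v \<Longrightarrow> P \<sigma> v"
  shows "P \<sigma> v"
proof -
  \<comment> \<open>Fixed-point induction varies all arguments and replaces recursive calls by an
    unknown \<open>rec\<close>. The equations pin the parameters, and the value of
    \<open>run\<close> is carried along because nothing else is known about
    \<open>rec\<close>.\<close>
  have "F' = F \<longrightarrow> g' = g \<longrightarrow> run F g \<sigma>' = Some v' \<and> P \<sigma>' v'"
    if "run F' g' \<sigma>' = Some v'" for F' g' \<sigma>' v'
    using _ that
  proof (rule run.raw_induct)
    fix rec F' g' \<sigma> v
    assume IH: "\<And>F' g' \<sigma> v. rec F' g' \<sigma> = Some v \<Longrightarrow>
        F' = F \<longrightarrow> g' = g \<longrightarrow> run F g \<sigma> = Some v \<and> P \<sigma> v"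
      and "Option.bind (F' \<sigma>) (\<lambda>(i, q). if i = 1 then Some q
        else Option.bind (g' q) (\<lambda>a. rec F' g' (\<sigma> @ [a]))) = Some v"
    then show "F' = F \<longrightarrow> g' = g \<longrightarrow> run F g \<sigma> = Some v \<and> P \<sigma> v"
      by (auto simp: bind_eq_Some_conv run.simps[of F g \<sigma>] split: if_splits
          intro: assms(2,3))
  qed
  with assms(1) show ?thesis by blast
qed

lemma run_mono:
  assumes "run F g \<sigma> = Some v" "g \<subseteq>\<^sub>m g'"
  shows "run F g' \<sigma> = Some v"
  using assms
proof (induction rule: run_Some_induct)
  case (Halt \<sigma> q)
  then show ?case by (simp add: run.simps)
next
  case (Query \<sigma> i q a v)
  then show ?case using map_le_Some[of g g' q a] by (subst run.simps) auto
qed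

text \<open>The oracle \<open>G u\<close> may itself be computed sequentially from \<open>u\<close>,
  so operators can be nested. Follow the successful run at \<open>u'\<close> to the first query that
  \<open>G u\<close> leaves open: what blocks that query blocks the whole run.\<close>

lemma seq_op_run:
  assumes G: "\<And>q. seq_op (\<lambda>u. G u q)"
  shows "seq_op (\<lambda>u. run F (G u) \<sigma>)"
  unfolding seq_op_def
proof (intro conjI allI impI)
  fix u u' v
  assume le: "u \<subseteq>\<^sub>m u'" and v: "run F (G u) \<sigma> = Some v"
  have "G u \<subseteq>\<^sub>m G u'"
    by (rule map_leI) (rule seq_op_mono[OF G le])
  with v show "run F (G u') \<sigma> = Some v" by (rule run_mono)
next
  fix u u'
  assume le: "u \<subseteq>\<^sub>m u'" and N: "run F (G u) \<sigma> = None" and "run F (G u') \<sigma> \<noteq> None"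
  then obtain v where "run F (G u') \<sigma> = Some v" by auto
  then show "\<exists>q. u q = None \<and> (\<forall>u''. u \<subseteq>\<^sub>m u'' \<longrightarrow> u'' q = None \<longrightarrow> run F (G u'') \<sigma> = None)"
    using N
  proof (induction rule: run_Some_induct)
    case (Halt \<sigma> q)
    then show ?case by (simp add: run.simps)
  next
    case (Query \<sigma> i q a v)
    have step: "run F (G w) \<sigma> = Option.bind (G w q) (\<lambda>a. run F (G w) (\<sigma> @ [a]))" for w
      using Query.hyps by (subst run.simps) auto
    show ?case
    proof (cases "G u q")
      case None
      with Query.hyps obtain p where "u p = None"
          "\<And>u''. u \<subseteq>\<^sub>m u'' \<Longrightarrow> u'' p = None \<Longrightarrow> G u'' q = None"
        by (auto intro: seq_op_stuck[OF G le])
      then show ?thesis by (auto simp: step)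
    next
      case (Some a')
      then have "a' = a" using seq_op_mono[OF G le] Query.hyps by fastforce
      with Some Query.prems have "run F (G u) (\<sigma> @ [a]) = None" by (simp add: step)
      from Query.IH[OF this] obtain p where p: "u p = None"
          "\<And>u''. u \<subseteq>\<^sub>m u'' \<Longrightarrow> u'' p = None \<Longrightarrow> run F (G u'') (\<sigma> @ [a]) = None"
        by auto
      have "G u'' q = Some a" if "u \<subseteq>\<^sub>m u''" for u''
        using seq_op_mono[OF G that] Some \<open>a' = a\<close> by auto
      with p show ?thesis by (auto simp: step)
    qed
  qed
qed

lemma seq_op_seq_comp: "(\<And>q. seq_op (\<lambda>u. G u q)) \<Longrightarrow> seq_op (\<lambda>u. seq_comp F (G u) n)"
  unfolding seq_comp_def by (rule seq_op_run)

lemma seq_comp_mono: "g \<subseteq>\<^sub>m g' \<Longrightarrow> seq_comp F g \<subseteq>\<^sub>m seq_comp F g'"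
  by (rule map_leI) (auto simp: seq_comp_def intro: run_mono)

lemma seq_op_join:
  assumes "\<And>q. seq_op (\<lambda>u. G u q)" "\<And>q. seq_op (\<lambda>u. H u q)"
  shows "seq_op (\<lambda>u. subT_join (G u) (H u) q)"
  using assms by (cases "even q") (simp_all add: subT_join_def)

lemma subT_join_mono: "f \<subseteq>\<^sub>m f' \<Longrightarrow> g \<subseteq>\<^sub>m g' \<Longrightarrow> subT_join f g \<subseteq>\<^sub>m subT_join f' g'"
  by (rule map_leI) (auto simp: subT_join_def split: if_splits dest: map_le_Some)

lemma seq_op_meet:
  assumes "\<And>q. seq_op (\<lambda>u. G u q)" "\<And>q. seq_op (\<lambda>u. H u q)"
  shows "seq_op (\<lambda>u. subT_meet (G u) (H u) k)"
  unfolding subT_meet_def Let_def by (intro seq_op_agree seq_op_seq_comp assms)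

section \<open>The two sides of the meet as separate upper bounds\<close>

definition meet_left :: "(nat \<rightharpoonup> nat) \<Rightarrow> nat \<rightharpoonup> nat" where
  "meet_left f k = seq_comp (Phi (fst (prod_decode k))) f (snd (prod_decode (snd (prod_decode k))))"

definition meet_right :: "(nat \<rightharpoonup> nat) \<Rightarrow> nat \<rightharpoonup> nat" where
  "meet_right g k = seq_comp (Phi (fst (prod_decode (snd (prod_decode k))))) g
     (snd (prod_decode (snd (prod_decode k))))"

lemma subT_meet_eq:
  "subT_meet f g k = (if meet_left f k = meet_right g k then meet_left f k else None)"
  by (simp add: subT_meet_def meet_left_def meet_right_def Let_def)

lemma subT_meet_le_left: "subT_meet f g \<subseteq>\<^sub>m meet_left f"
  by (rule map_leI) (auto simp: subT_meet_eq split: if_splits)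

lemma subT_meet_le_right: "subT_meet f g \<subseteq>\<^sub>m meet_right g"
  by (rule map_leI) (auto simp: subT_meet_eq split: if_splits)

lemma meet_left_mono: "f \<subseteq>\<^sub>m f' \<Longrightarrow> meet_left f \<subseteq>\<^sub>m meet_left f'"
  by (rule map_leI) (auto simp: meet_left_def intro: map_le_Some[OF seq_comp_mono])

lemma meet_right_mono: "f \<subseteq>\<^sub>m f' \<Longrightarrow> meet_right f \<subseteq>\<^sub>m meet_right f'"
  by (rule map_leI) (auto simp: meet_right_def intro: map_le_Some[OF seq_comp_mono])

lemma subT_meet_mono:
  assumes "f \<subseteq>\<^sub>m f'" "g \<subseteq>\<^sub>m g'"
  shows "subT_meet f g \<subseteq>\<^sub>m subT_meet f' g'"
proof (rule map_leI)
  fix k v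
  assume "subT_meet f g k = Some v"
  then have "meet_left f k = Some v" "meet_right g k = Some v"
    by (auto dest: map_le_Some[OF subT_meet_le_left] map_le_Some[OF subT_meet_le_right])
  then have "meet_left f' k = Some v" "meet_right g' k = Some v"
    using assms by (auto intro: map_le_Some[OF meet_left_mono] map_le_Some[OF meet_right_mono])
  then show "subT_meet f' g' k = Some v" by (simp add: subT_meet_eq)
qed

section \<open>The diagonalization\<close>

definition even_part :: "(nat \<rightharpoonup> nat) \<Rightarrow> nat \<rightharpoonup> nat" where
  "even_part b n = (if even n then b n else None)"

lemma seq_op_even_part: "(\<And>q. seq_op (\<lambda>u. G u q)) \<Longrightarrow> seq_op (\<lambda>u. even_part (G u) n)"
  by (cases "even n") (simp_all add: even_part_def seq_op_const)

lemma even_part_mono: "b \<subseteq>\<^sub>m b' \<Longrightarrow> even_part b \<subseteq>\<^sub>m even_part b'"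
  by (rule map_leI) (auto simp: even_part_def split: if_splits dest: map_le_Some)

text \<open>
  A tuple \<open>(i, j, e\<^sub>0, e\<^sub>1, e\<^sub>2, e\<^sub>3, e\<^sub>4)\<close> describes a would-be reduction of the values of
  \<open>b \<and> (a \<or> c)\<close> at the arguments \<open>\<langle>i, j, n\<rangle>\<close> to \<open>a \<or> (b \<and> c)\<close>. The indices \<open>e\<^sub>1, \<dots>, e\<^sub>4\<close>
  absorb the choice of representatives of the degrees, so that transitivity of the reducibility
  and a universal machine are never needed.
\<close>

type_synonym req = "nat \<times> nat \<times> nat \<times> nat \<times> nat \<times> nat \<times> nat"

definition outer :: "req \<Rightarrow> (nat \<rightharpoonup> nat) \<Rightarrow> (nat \<rightharpoonup> nat) \<Rightarrow> nat \<rightharpoonup> nat" where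
  "outer = (\<lambda>(i, j, e\<^sub>0, e\<^sub>1, e\<^sub>2, e\<^sub>3, e\<^sub>4) a m n.
     seq_comp (Phi e\<^sub>0) (subT_join (seq_comp (Phi e\<^sub>1) a) (seq_comp (Phi e\<^sub>2) m))
       (prod_encode (i, prod_encode (j, n))))"

definition inner_b :: "req \<Rightarrow> (nat \<rightharpoonup> nat) \<Rightarrow> nat \<rightharpoonup> nat" where
  "inner_b = (\<lambda>(i, j, e\<^sub>0, e\<^sub>1, e\<^sub>2, e\<^sub>3, e\<^sub>4). seq_comp (Phi e\<^sub>3))"

definition inner_c :: "req \<Rightarrow> (nat \<rightharpoonup> nat) \<Rightarrow> nat \<rightharpoonup> nat" where
  "inner_c = (\<lambda>(i, j, e\<^sub>0, e\<^sub>1, e\<^sub>2, e\<^sub>3, e\<^sub>4). seq_comp (Phi e\<^sub>4))"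

definition candidate :: "req \<Rightarrow> (nat \<rightharpoonup> nat) \<Rightarrow> (nat \<rightharpoonup> nat) \<Rightarrow> nat \<rightharpoonup> nat" where
  "candidate R b c = outer R (even_part b) (subT_meet (inner_b R b) (inner_c R c))"

lemma seq_op_outer:
  assumes "\<And>q. seq_op (\<lambda>u. G u q)" "\<And>q. seq_op (\<lambda>u. H u q)"
  shows "seq_op (\<lambda>u. outer R (G u) (H u) n)"
  by (cases R) (simp add: outer_def seq_op_seq_comp seq_op_join assms)

lemma outer_mono: "a \<subseteq>\<^sub>m a' \<Longrightarrow> m \<subseteq>\<^sub>m m' \<Longrightarrow> outer R a m n = Some v \<Longrightarrow> outer R a' m' n = Some v"
  by (cases R)
    (auto simp: outer_def intro: map_le_Some[OF seq_comp_mono[OF subT_join_mono]] seq_comp_mono)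

lemma seq_op_inner_b: "(\<And>q. seq_op (\<lambda>u. G u q)) \<Longrightarrow> seq_op (\<lambda>u. inner_b R (G u) n)"
  by (cases R) (simp add: inner_b_def seq_op_seq_comp)

lemma seq_op_inner_c: "(\<And>q. seq_op (\<lambda>u. G u q)) \<Longrightarrow> seq_op (\<lambda>u. inner_c R (G u) n)"
  by (cases R) (simp add: inner_c_def seq_op_seq_comp)

lemma inner_b_mono: "b \<subseteq>\<^sub>m b' \<Longrightarrow> inner_b R b \<subseteq>\<^sub>m inner_b R b'"
  by (cases R) (simp add: inner_b_def seq_comp_mono)

lemma seq_op_meet_left: "(\<And>q. seq_op (\<lambda>u. G u q)) \<Longrightarrow> seq_op (\<lambda>u. meet_left (G u) n)"
  by (simp add: meet_left_def seq_op_seq_comp)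

lemma seq_op_meet_right: "(\<And>q. seq_op (\<lambda>u. G u q)) \<Longrightarrow> seq_op (\<lambda>u. meet_right (G u) n)"
  by (simp add: meet_right_def seq_op_seq_comp)

lemma seq_op_candidate: "seq_op (\<lambda>u. candidate R (u \<circ> Inl) (u \<circ> Inr) n)"
  unfolding candidate_def
  by (intro seq_op_outer seq_op_even_part seq_op_meet seq_op_inner_b seq_op_inner_c)
    (simp_all add: seq_op_query)

text \<open>Both oracles are merged into one on a sum type. The common part of the pairs
  \<open>(a\<^sub>1, m\<^sub>1)\<close> and \<open>(a\<^sub>2, m\<^sub>2)\<close> lies below the
  mixed pair \<open>(a\<^sub>1, m\<^sub>2)\<close>.\<close>

lemma outer_stable:
  assumes le: "a\<^sub>1 \<subseteq>\<^sub>m a" "a\<^sub>2 \<subseteq>\<^sub>m a" "m\<^sub>1 \<subseteq>\<^sub>m m" "m\<^sub>2 \<subseteq>\<^sub>m m"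
    and v: "outer R a\<^sub>1 m\<^sub>1 n = Some v" "outer R a\<^sub>2 m\<^sub>2 n = Some v'"
  shows "outer R a\<^sub>1 m\<^sub>2 n = Some v"
proof -
  let ?T = "\<lambda>u. outer R (u \<circ> Inl) (u \<circ> Inr) n"
  let ?u1 = "case_sum a\<^sub>1 m\<^sub>1" and ?u2 = "case_sum a\<^sub>2 m\<^sub>2"
  let ?i = "\<lambda>q. if ?u1 q = ?u2 q then ?u1 q else None"
  have T: "seq_op ?T" by (intro seq_op_outer) (simp_all add: seq_op_query)
  have "?T ?i = Some v"
    by (rule seq_op_stable[OF T, of _ "case_sum a m"])
      (use le v in \<open>auto intro!: map_leI dest: map_le_Some simp: o_def split: sum.splits\<close>)
  then show ?thesis
    by (rule outer_mono[rotated 2]) (auto intro!: map_leI split: if_splits)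
qed

section \<open>Adding one block\<close>

lemma exists_fresh:
  assumes "finite (S :: nat set)"
  shows "\<exists>k. k \<notin> S \<and> even k" "\<exists>k. k \<notin> S \<and> odd k"
proof -
  obtain m where m: "\<forall>x\<in>S. x < m" using assms finite_nat_set_iff_bounded by blast
  have "2 * m \<notin> S" "2 * m + 1 \<notin> S" using m by force+
  moreover have "even (2 * m)" "odd (2 * m + 1)" by simp_all
  ultimately show "\<exists>k. k \<notin> S \<and> even k" "\<exists>k. k \<notin> S \<and> odd k" by blast+
qed

text \<open>\<open>Z\<close> holds the arguments reserved to stay undefined. The order of choice is
  decisive: \<open>d\<close> comes first; then either \<open>x\<close> before \<open>s\<close>, or
  \<open>s\<close>, \<open>x\<close> and finally \<open>r\<close>, so that the last choice can avoid
  the query on which a computation is stuck.\<close>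

lemma extension_step:
  assumes fin: "finite (dom b)" "finite (dom c)" "finite Z"
  obtains d s r x where "odd d" "even s" "even r"
    "{d, s, r} \<inter> (dom b \<union> dom c \<union> Z) = {}"
    "candidate R (b(s \<mapsto> r, d \<mapsto> x)) (c(d \<mapsto> s, r \<mapsto> x)) d \<noteq> Some x"
proof -
  let ?B = "dom b \<union> dom c \<union> Z"
  have B: "finite ?B" using fin by simp
  obtain d where d: "d \<notin> ?B" "odd d" using exists_fresh(2)[OF B] by blast
  \<comment> \<open>Replacing the meet by its left side gives an upper bound of
    \<open>candidate\<close> that depends on \<open>b\<close> only.\<close>
  define Zb where "Zb = (\<lambda>b. outer R (even_part b) (meet_left (inner_b R b)) d)"
  have seq_Zb: "seq_op Zb"
    unfolding Zb_def
    by (intro seq_op_outer seq_op_even_part seq_op_meet_left seq_op_inner_b seq_op_query)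
  have candidate_Zb: "candidate R b c d = Some v \<Longrightarrow> Zb b = Some v" for b c v
    unfolding candidate_def Zb_def by (erule outer_mono[rotated 2]) (auto intro: subT_meet_le_left)
  show ?thesis
  proof (cases "\<exists>x. Zb (b(d \<mapsto> x)) \<noteq> Some x")
    case True
    \<comment> \<open>The \<open>b\<close>-side alone fails to compute \<open>x\<close>; taking \<open>s\<close> outside \<open>S\<close> keeps it failing.\<close>
    then obtain x where x: "Zb (b(d \<mapsto> x)) \<noteq> Some x" by blast
    obtain S where S: "finite S" "S \<inter> dom (b(d \<mapsto> x)) = {}"
        "\<And>b'. b(d \<mapsto> x) \<subseteq>\<^sub>m b' \<Longrightarrow> S \<inter> dom b' = {} \<Longrightarrow> Zb b' \<noteq> Some x"
      using seq_op_avoid[OF seq_Zb, OF x] by blast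
    obtain s where s: "s \<notin> ?B \<union> S" "even s"
      using exists_fresh(1)[OF finite_UnI[OF B S(1)]] by blast
    have "Zb (b(s \<mapsto> s, d \<mapsto> x)) \<noteq> Some x"
    proof (rule S(3))
      show "b(d \<mapsto> x) \<subseteq>\<^sub>m b(s \<mapsto> s, d \<mapsto> x)" using s by (auto simp: map_le_def)
      show "S \<inter> dom (b(s \<mapsto> s, d \<mapsto> x)) = {}" using S(2) s by auto
    qed
    then show ?thesis
      \<comment> \<open>The failure does not involve \<open>c\<close>, so \<open>r = s\<close> is a
        permissible choice.\<close>
      using that[of d s s x] d s candidate_Zb by blast
  next
    case False
    \<comment> \<open>The \<open>b\<close>-side computes \<open>x\<close> without the pair \<open>(s, r)\<close>, so by stability any successful
      computation from \<open>a \<or> (b \<and> c)\<close> ignores it as well; but then the \<open>c\<close>-side alone, without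
      \<open>r\<close>, would have to know \<open>x\<close>, which is chosen to differ from what it yields.\<close>
    obtain s where s: "s \<notin> ?B" "even s" using exists_fresh(1)[OF B] by blast
    \<comment> \<open>Here the meet is replaced by its right side and the even part is frozen before
      \<open>s\<close> is added, leaving a function of \<open>c\<close> only.\<close>
    define Yc where "Yc = (\<lambda>c. outer R (even_part b) (meet_right (inner_c R c)) d)"
    have seq_Yc: "seq_op Yc"
      unfolding Yc_def
      by (intro seq_op_outer seq_op_meet_right seq_op_inner_c seq_op_query seq_op_const)
    \<comment> \<open>The left side is fixed before \<open>x\<close> is chosen, so it differs from
      \<open>Some 0\<close> or from \<open>Some 1\<close>.\<close>
    obtain x :: nat where x: "Yc (c(d \<mapsto> s)) \<noteq> Some x"
      by (metis option.inject zero_neq_one)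
    obtain S where S: "finite S" "S \<inter> dom (c(d \<mapsto> s)) = {}"
        "\<And>c'. c(d \<mapsto> s) \<subseteq>\<^sub>m c' \<Longrightarrow> S \<inter> dom c' = {} \<Longrightarrow> Yc c' \<noteq> Some x"
      using seq_op_avoid[OF seq_Yc, OF x] by blast
    obtain r where r: "r \<notin> ?B \<union> S" "even r"
      using exists_fresh(1)[OF finite_UnI[OF B S(1)]] by blast
    let ?b' = "b(s \<mapsto> r, d \<mapsto> x)" and ?c' = "c(d \<mapsto> s, r \<mapsto> x)"
    have rd: "r \<noteq> d" using r d by auto
    have Y: "Yc ?c' \<noteq> Some x"
    proof (rule S(3))
      show "c(d \<mapsto> s) \<subseteq>\<^sub>m ?c'" using r rd by (auto simp: map_le_def)
      show "S \<inter> dom ?c' = {}" using S(2) r by auto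
    qed
    have ev: "even_part (b(d \<mapsto> x)) = even_part b"
      using d by (auto simp: even_part_def)
    have b1: "b(d \<mapsto> x) \<subseteq>\<^sub>m ?b'" using s by (auto simp: map_le_def)
    have "candidate R ?b' ?c' d \<noteq> Some x"
    proof
      let ?N = "subT_meet (inner_b R ?b') (inner_c R ?c')"
      assume "candidate R ?b' ?c' d = Some x"
      then have "outer R (even_part ?b') ?N d = Some x" by (simp add: candidate_def)
      moreover have "outer R (even_part b) (meet_left (inner_b R (b(d \<mapsto> x)))) d = Some x"
        using False ev unfolding Zb_def by metis
      \<comment> \<open>Both computations lie below \<open>even_part ?b'\<close> and
        \<open>meet_left (inner_b R ?b')\<close>. Stability combines the first oracle of one with
        the second oracle of the other.\<close>
      ultimately have "outer R (even_part b) ?N d = Some x"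
        using ev even_part_mono[OF b1]
        by (intro outer_stable[of "even_part b" "even_part ?b'" "even_part ?b'"
              "meet_left (inner_b R (b(d \<mapsto> x)))" "meet_left (inner_b R ?b')" ?N])
          (simp_all del: fun_upd_apply add: subT_meet_le_left meet_left_mono inner_b_mono b1)
      then have "Yc ?c' = Some x"
        unfolding Yc_def by (rule outer_mono[rotated 2]) (auto intro: subT_meet_le_right)
      with Y show False by contradiction
    qed
    then show ?thesis
      using that[of d s r x] d s r by blast
  qed
qed

section \<open>The infinite construction\<close>

lemma chain_limit:
  fixes f :: "nat \<Rightarrow> 'q \<rightharpoonup> 'r"
  assumes chain: "\<And>n. f n \<subseteq>\<^sub>m f (Suc n)"
  obtains g where "\<And>n. f n \<subseteq>\<^sub>m g" "\<And>q. q \<in> dom g \<Longrightarrow> \<exists>n. f n q = g q"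
proof
  define g where "g q = (if \<exists>n. f n q \<noteq> None then f (LEAST n. f n q \<noteq> None) q else None)" for q
  have le: "f m \<subseteq>\<^sub>m f n" if "m \<le> n" for m n
    using that by (induction rule: dec_induct) (auto intro: map_le_trans chain)
  show "f n \<subseteq>\<^sub>m g" for n
  proof (rule map_leI)
    fix q v assume v: "f n q = Some v"
    then have ex: "f n q \<noteq> None" by simp
    have "f (LEAST n. f n q \<noteq> None) \<subseteq>\<^sub>m f n"
      by (rule le) (rule Least_le, rule ex)
    moreover have "f (LEAST n. f n q \<noteq> None) q \<noteq> None" using ex by (rule LeastI)
    ultimately have "f (LEAST n. f n q \<noteq> None) q = Some v"
      using v by (auto dest: map_le_Some)
    then show "g q = Some v" using ex by (auto simp: g_def)
  qed
  show "\<exists>n. f n q = g q" if "q \<in> dom g" for q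
    using that by (auto simp: g_def split: if_splits)
qed

lemma exists_diagonal_pair:
  fixes R :: "nat \<Rightarrow> req"
  shows "\<exists>b c.
    (\<forall>d x. odd d \<longrightarrow> b d = Some x \<longrightarrow>
       (\<exists>s r. even s \<and> c d = Some s \<and> b s = Some r \<and> c r = Some x)) \<and>
    (\<forall>n. \<exists>d x. odd d \<and> b d = Some x \<and> candidate (R n) b c d \<noteq> Some x)"
proof -
  \<comment> \<open>\<open>b\<close> and \<open>c\<close> are carried as the two halves of one
    partial function \<open>u\<close>, so that a single oracle, and a single reserved set, controls
    both.\<close>
  define linked :: "(nat + nat \<rightharpoonup> nat) \<Rightarrow> bool" where
    "linked u \<longleftrightarrow> (\<forall>d x. odd d \<longrightarrow> u (Inl d) = Some x \<longrightarrow>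
       (\<exists>s r. even s \<and> u (Inr d) = Some s \<and> u (Inl s) = Some r \<and> u (Inr r) = Some x))" for u
  define good where
    "good = (\<lambda>(u :: nat + nat \<rightharpoonup> nat, Z).
       finite (dom u) \<and> finite Z \<and> Z \<inter> dom u = {} \<and> linked u)"
  \<comment> \<open>Failure is demanded for every extension respecting \<open>Z'\<close>, since it
    has to survive in the limit.\<close>
  define next_to where
    "next_to n = (\<lambda>(u :: nat + nat \<rightharpoonup> nat, Z) (u', Z'). u \<subseteq>\<^sub>m u' \<and> Z \<subseteq> Z' \<and>
       (\<exists>d x. odd d \<and> u' (Inl d) = Some x \<and>
         (\<forall>w. u' \<subseteq>\<^sub>m w \<longrightarrow> Z' \<inter> dom w = {} \<longrightarrow> candidate (R n) (w \<circ> Inl) (w \<circ> Inr) d \<noteq> Some x)))" for n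
  have step: "\<exists>p'. good p' \<and> next_to n p p'" if "good p" for p n
  proof -
    obtain u Z where p: "p = (u, Z)" by fastforce
    with that have g: "finite (dom u)" "finite Z" "Z \<inter> dom u = {}" "linked u"
      by (auto simp: good_def)
    let ?b = "u \<circ> Inl" and ?c = "u \<circ> Inr" and ?Z = "Inl -` Z \<union> Inr -` Z"
    have fin: "finite (dom ?b)" "finite (dom ?c)" "finite ?Z"
    proof -
      have "dom ?b = Inl -` dom u" "dom ?c = Inr -` dom u" by auto
      then show "finite (dom ?b)" "finite (dom ?c)" "finite ?Z"
        using g by (auto intro!: finite_vimageI)
    qed
    obtain d s r x where
      h: "odd d" "even s" "even r" "{d, s, r} \<inter> (dom ?b \<union> dom ?c \<union> ?Z) = {}"
      and neq: "candidate (R n) (?b(s \<mapsto> r, d \<mapsto> x)) (?c(d \<mapsto> s, r \<mapsto> x)) d \<noteq> Some x"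
      by (rule extension_step[OF fin])
    define u' where "u' = u(Inl s \<mapsto> r, Inl d \<mapsto> x, Inr d \<mapsto> s, Inr r \<mapsto> x)"
    have proj: "u' \<circ> Inl = ?b(s \<mapsto> r, d \<mapsto> x)" "u' \<circ> Inr = ?c(d \<mapsto> s, r \<mapsto> x)"
      by (auto simp: u'_def)
    have new: "Inl s \<notin> dom u \<union> Z" "Inl d \<notin> dom u \<union> Z" "Inr d \<notin> dom u \<union> Z" "Inr r \<notin> dom u \<union> Z"
      using h(4) by auto
    have distinct: "s \<noteq> d" "r \<noteq> d" using h by auto
    have le: "u \<subseteq>\<^sub>m u'" unfolding u'_def using new by (auto simp: map_le_def)
    have linked: "linked u'"
      unfolding linked_def
    proof (intro allI impI)
      fix d' x' assume d': "odd d'" "u' (Inl d') = Some x'"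
      show "\<exists>s r. even s \<and> u' (Inr d') = Some s \<and> u' (Inl s) = Some r \<and> u' (Inr r) = Some x'"
      proof (cases "d' = d")
        case True
        with d' h distinct show ?thesis by - (rule exI[of _ s], rule exI[of _ r], auto simp: u'_def)
      next
        case False
        \<comment> \<open>The new argument \<open>s\<close> is even, so \<open>d\<close> is the only
          odd argument added to the \<open>b\<close>-half.\<close>
        with d' h have "u (Inl d') = Some x'" by (auto simp: u'_def split: if_splits)
        with g(4) d'(1) obtain s' r' where "even s'" "u (Inr d') = Some s'" "u (Inl s') = Some r'"
            "u (Inr r') = Some x'"
          unfolding linked_def by blast
        then show ?thesis
          by - (rule exI[of _ s'], rule exI[of _ r'], simp_all add: map_le_Some[OF le])
      qed
    qed
    from neq have avoid: "candidate (R n) (u' \<circ> Inl) (u' \<circ> Inr) d \<noteq> Some x" by (simp add: proj)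
    obtain S where S: "finite S" "S \<inter> dom u' = {}"
        "\<And>w. u' \<subseteq>\<^sub>m w \<Longrightarrow> S \<inter> dom w = {} \<Longrightarrow> candidate (R n) (w \<circ> Inl) (w \<circ> Inr) d \<noteq> Some x"
      using seq_op_avoid[OF seq_op_candidate, OF avoid] by blast
    have "finite (dom u')" using g by (simp add: u'_def)
    moreover have "Z \<inter> dom u' = {}" using g(3) new by (auto simp: u'_def)
    ultimately have "good (u', Z \<union> S)" using g(2) S linked by (auto simp: good_def)
    moreover have "next_to n p (u', Z \<union> S)"
    proof -
      have "u' (Inl d) = Some x" using distinct by (simp add: u'_def)
      moreover have "candidate (R n) (w \<circ> Inl) (w \<circ> Inr) d \<noteq> Some x"
        if "u' \<subseteq>\<^sub>m w" "(Z \<union> S) \<inter> dom w = {}" for w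
        using that by (intro S(3)) auto
      ultimately show ?thesis
        unfolding p next_to_def prod.case using le h(1) by blast
    qed
    ultimately show ?thesis by blast
  qed
  have "good (Map.empty, {})" by (simp add: good_def linked_def)
  then obtain st where st: "\<And>n. good (st n)" "\<And>n. next_to n (st n) (st (Suc n))"
    using dependent_nat_choice[of "\<lambda>_. good" next_to] step by metis
  define u where "u n = fst (st n)" for n
  define Z where "Z n = snd (st n)" for n
  have st_eq: "st n = (u n, Z n)" for n by (simp add: u_def Z_def)
  have g: "Z n \<inter> dom (u n) = {}" "linked (u n)" for n
    using st(1)[of n] by (auto simp: st_eq good_def)
  have chain: "u n \<subseteq>\<^sub>m u (Suc n)" and Zchain: "Z n \<subseteq> Z (Suc n)" for n
    using st(2)[of n] by (auto simp: st_eq next_to_def)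
  obtain w where w: "\<And>n. u n \<subseteq>\<^sub>m w" "\<And>q. q \<in> dom w \<Longrightarrow> \<exists>n. u n q = w q"
    using chain_limit[of u, OF chain] by blast
  \<comment> \<open>A reserved argument in \<open>dom w\<close> would already be defined at some
    finite stage, and a later stage would then have it both reserved and defined.\<close>
  have disj: "Z n \<inter> dom w = {}" for n
  proof (rule ccontr)
    assume "Z n \<inter> dom w \<noteq> {}"
    then obtain q v where q: "q \<in> Z n" "w q = Some v" by auto
    with w(2) obtain m where m: "u m q = Some v" by (metis domI)
    have "q \<in> Z (max m n)"
      using q(1) lift_Suc_mono_le[of Z, OF Zchain, of n "max m n"] by auto
    moreover have "u m \<subseteq>\<^sub>m u (max m n)"
      by (rule dec_induct[of m "max m n"]) (auto intro: map_le_trans chain)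
    then have "q \<in> dom (u (max m n))" using m by (auto dest: map_le_Some)
    ultimately show False using g(1) by blast
  qed
  show ?thesis
  proof (rule exI[of _ "w \<circ> Inl"], rule exI[of _ "w \<circ> Inr"], intro conjI allI impI)
    fix d x assume d: "odd d" "(w \<circ> Inl) d = Some x"
    then obtain n where "u n (Inl d) = Some x" using w(2)[of "Inl d"] by auto
    with g(2)[of n] d(1) obtain s r where "even s" "u n (Inr d) = Some s" "u n (Inl s) = Some r"
        "u n (Inr r) = Some x"
      unfolding linked_def by blast
    then show "\<exists>s r. even s \<and> (w \<circ> Inr) d = Some s \<and> (w \<circ> Inl) s = Some r \<and>
        (w \<circ> Inr) r = Some x"
      by - (rule exI[of _ s], rule exI[of _ r], simp_all add: map_le_Some[OF w(1)])
  next
    fix n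
    from st(2)[of n] obtain d x where "odd d" "u (Suc n) (Inl d) = Some x"
        "candidate (R n) (w \<circ> Inl) (w \<circ> Inr) d \<noteq> Some x"
      using w(1)[of "Suc n"] disj[of "Suc n"] by (auto simp: st_eq next_to_def)
    then show "\<exists>d x. odd d \<and> (w \<circ> Inl) d = Some x \<and> candidate (R n) (w \<circ> Inl) (w \<circ> Inr) d \<noteq> Some x"
      by - (rule exI[of _ d], rule exI[of _ x], simp_all add: map_le_Some[OF w(1)])
  qed
qed

section \<open>Two reductions\<close>

definition total_rec :: "(nat \<Rightarrow> nat) \<Rightarrow> bool" where
  "total_rec h \<longleftrightarrow> (\<exists>p. \<forall>n. eval p n = Some (h n))"

lemma total_recI: "(\<And>n. eval p n = Some (h n)) \<Longrightarrow> total_rec h"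
  unfolding total_rec_def by blast

lemma total_rec_comp:
  assumes "total_rec f" "total_rec g"
  shows "total_rec (\<lambda>x. f (g x))"
proof -
  obtain p q where "\<And>n. eval p n = Some (f n)" "\<And>n. eval q n = Some (g n)"
    using assms unfolding total_rec_def by blast
  then show ?thesis by (intro total_recI[of "Comp p q"]) simp
qed

lemma total_rec_zero: "total_rec (\<lambda>x. 0)"
  by (rule total_recI[of Zero]) simp

text \<open>No constructor is the identity, but decoding a pair and encoding it again is.\<close>

lemma total_rec_id: "total_rec (\<lambda>x. x)"
  by (rule total_recI[of "Pairing Fst Snd"]) simp

lemma total_rec_Suc: "total_rec f \<Longrightarrow> total_rec (\<lambda>x. Suc (f x))"
  by (rule total_rec_comp[of Suc]) (auto intro: total_recI[of Succ])

lemma total_rec_fst: "total_rec f \<Longrightarrow> total_rec (\<lambda>x. fst (prod_decode (f x)))"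
  by (rule total_rec_comp[of "\<lambda>x. fst (prod_decode x)"]) (auto intro: total_recI[of Fst])

lemma total_rec_snd: "total_rec f \<Longrightarrow> total_rec (\<lambda>x. snd (prod_decode (f x)))"
  by (rule total_rec_comp[of "\<lambda>x. snd (prod_decode x)"]) (auto intro: total_recI[of Snd])

lemma total_rec_prim_rec:
  assumes "total_rec f" "total_rec g" "total_rec h" "total_rec k"
  shows "total_rec (\<lambda>x. rec_nat (f (h x)) (\<lambda>m y. g (prod_encode (h x, prod_encode (m, y)))) (k x))"
proof -
  obtain pf pg ph pk where p: "\<And>n. eval pf n = Some (f n)" "\<And>n. eval pg n = Some (g n)"
      "\<And>n. eval ph n = Some (h n)" "\<And>n. eval pk n = Some (k n)"
    using assms unfolding total_rec_def by blast
  have "rec_nat (Some (f a)) (\<lambda>m r. Option.bind r (\<lambda>y. Some (g (prod_encode (a, prod_encode (m, y)))))) n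
      = Some (rec_nat (f a) (\<lambda>m y. g (prod_encode (a, prod_encode (m, y)))) n)" for a n
    by (induction n) auto
  then have "eval (Comp (Prec pf pg) (Pairing ph pk)) x =
      Some (rec_nat (f (h x)) (\<lambda>m y. g (prod_encode (h x, prod_encode (m, y)))) (k x))" for x
    by (simp add: p map_comp_def)
  then show ?thesis unfolding total_rec_def by blast
qed

text \<open>A case distinction is a primitive recursion on \<open>k x\<close> whose step ignores the
  previous value.\<close>

lemma total_rec_if:
  assumes "total_rec k" "total_rec f" "total_rec g"
  shows "total_rec (\<lambda>x. if k x = 0 then f x else g x)"
proof -
  have "total_rec (\<lambda>x. g (fst (prod_decode x)))"
    by (intro total_rec_comp[OF assms(3)] total_rec_fst total_rec_id)
  from total_rec_prim_rec[OF assms(2) this total_rec_id assms(1)]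
  have "total_rec (\<lambda>x. rec_nat (f x) (\<lambda>m y. g x) (k x))" by simp
  moreover have "rec_nat (f x) (\<lambda>m y. g x) (k x) = (if k x = 0 then f x else g x)" for x
    by (cases "k x") auto
  ultimately show ?thesis by simp
qed

lemma total_rec_pred:
  assumes "total_rec k"
  shows "total_rec (\<lambda>x. k x - 1)"
proof -
  have "total_rec (\<lambda>x. fst (prod_decode (snd (prod_decode x))))"
    by (intro total_rec_fst total_rec_snd total_rec_id)
  from total_rec_prim_rec[OF total_rec_zero this total_rec_id assms]
  have "total_rec (\<lambda>x. rec_nat 0 (\<lambda>m y. m) (k x))" by simp
  moreover have "rec_nat 0 (\<lambda>m y. m) n = n - 1" for n :: nat by (cases n) auto
  ultimately show ?thesis by simp
qed

lemma total_rec_double: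
  assumes "total_rec k"
  shows "total_rec (\<lambda>x. 2 * k x)"
proof -
  have "total_rec (\<lambda>x. Suc (Suc (snd (prod_decode (snd (prod_decode x))))))"
    by (intro total_rec_Suc total_rec_snd total_rec_id)
  from total_rec_prim_rec[OF total_rec_zero this total_rec_id assms]
  have "total_rec (\<lambda>x. rec_nat 0 (\<lambda>m y. Suc (Suc y)) (k x))" by simp
  moreover have "rec_nat 0 (\<lambda>m y. Suc (Suc y)) n = 2 * n" for n :: nat by (induction n) auto
  ultimately show ?thesis by simp
qed

text \<open>The code of a nonempty list is the successor of a pair code, whence the
  \<open>m - 1\<close>.\<close>

definition code_hd :: "nat \<Rightarrow> nat" where
  "code_hd m = fst (prod_decode (m - 1))"

definition code_tl :: "nat \<Rightarrow> nat" where
  "code_tl m = snd (prod_decode (m - 1))"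

lemma code_hd_tl [simp]:
  "code_hd (list_encode (x # xs)) = x" "code_tl (list_encode (x # xs)) = list_encode xs"
  by (simp_all add: code_hd_def code_tl_def)

lemma total_rec_hd: "total_rec f \<Longrightarrow> total_rec (\<lambda>x. code_hd (f x))"
  unfolding code_hd_def by (intro total_rec_fst total_rec_pred)

lemma total_rec_tl: "total_rec f \<Longrightarrow> total_rec (\<lambda>x. code_tl (f x))"
  unfolding code_tl_def by (intro total_rec_snd total_rec_pred)

lemmas total_rec_intros = total_rec_if total_rec_hd total_rec_tl total_rec_double total_rec_Suc
  total_rec_id

lemma list_encode_eq_0_iff: "list_encode xs = 0 \<longleftrightarrow> xs = []"
  by (cases xs) auto

lemma total_rec_Phi:
  assumes "total_rec h"
  shows "\<exists>e. \<forall>\<sigma>. Phi e \<sigma> = Some (h (list_encode \<sigma>) mod 2, h (list_encode \<sigma>) div 2)"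
proof -
  from assms obtain p where "\<And>n. eval p n = Some (h n)" unfolding total_rec_def by blast
  then show ?thesis by (intro exI[of _ "recf_index p"]) (simp add: Phi_def recf_of_index)
qed

text \<open>Besides reflexivity, this supplies an index for which the left side of a meet is the
  left function itself.\<close>

lemma identity_program: "\<exists>e. \<forall>g. seq_comp (Phi e) g = g"
proof -
  \<comment> \<open>An even output \<open>2 * q\<close> asks the query \<open>q\<close>; an odd
    output \<open>Suc (2 * q)\<close> halts with \<open>q\<close>. The length of the history selects
    the phase.\<close>
  let ?h = "\<lambda>m. if code_tl m = 0 then 2 * code_hd m else Suc (2 * code_hd (code_tl m))"
  have h: "total_rec ?h" by (intro total_rec_intros)
  obtain e where e: "\<And>\<sigma>. Phi e \<sigma> = Some (?h (list_encode \<sigma>) mod 2, ?h (list_encode \<sigma>) div 2)"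
    using total_rec_Phi[OF h] by blast
  have 1: "Phi e [n] = Some (0, n)" for n
    unfolding e by (simp del: list_encode.simps(2))
  have 2: "Phi e [n, v] = Some (1, v)" for n v
    unfolding e by (simp del: list_encode.simps(2) add: list_encode_eq_0_iff)
  have "seq_comp (Phi e) g n = g n" for g n
    by (cases "g n") (simp_all add: seq_comp_def run.simps[of "Phi e" g "[n]"]
        run.simps[of "Phi e" g "[n, v]" for v] 1 2)
  then show ?thesis by blast
qed

lemma subT_leI: "f \<subseteq>\<^sub>m g \<Longrightarrow> f \<le>\<^sub>s\<^sub>u\<^sub>b\<^sub>T g"
  unfolding subT_le_def by (metis identity_program)

lemma alternating_program:
  "\<exists>e. \<forall>f g d s r x. g d = Some s \<longrightarrow> f s = Some r \<longrightarrow> g r = Some x \<longrightarrow>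
    seq_comp (Phi e) (subT_join f g) d = Some x"
proof -
  \<comment> \<open>Within a query, \<open>Suc (2 * n)\<close> addresses \<open>g\<close> and
    \<open>2 * n\<close> addresses \<open>f\<close>; the outer factor 2 marks it as a query.\<close>
  let ?h = "\<lambda>m. if code_tl m = 0 then 2 * Suc (2 * code_hd m)
    else if code_tl (code_tl m) = 0 then 2 * (2 * code_hd (code_tl m))
    else if code_tl (code_tl (code_tl m)) = 0 then 2 * Suc (2 * code_hd (code_tl (code_tl m)))
    else Suc (2 * code_hd (code_tl (code_tl (code_tl m))))"
  have h: "total_rec ?h" by (intro total_rec_intros)
  obtain e where e: "\<And>\<sigma>. Phi e \<sigma> = Some (?h (list_encode \<sigma>) mod 2, ?h (list_encode \<sigma>) div 2)"
    using total_rec_Phi[OF h] by blast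
  have 1: "Phi e [d] = Some (0, Suc (2 * d))" for d
    unfolding e by (simp del: list_encode.simps(2))
  have 2: "Phi e [d, s] = Some (0, 2 * s)" for d s
    unfolding e by (simp del: list_encode.simps(2) add: list_encode_eq_0_iff)
  have 3: "Phi e [d, s, r] = Some (0, Suc (2 * r))" for d s r
    unfolding e by (simp del: list_encode.simps(2) add: list_encode_eq_0_iff)
  have 4: "Phi e [d, s, r, x] = Some (1, x)" for d s r x
    unfolding e by (simp del: list_encode.simps(2) add: list_encode_eq_0_iff)
  show ?thesis
  proof (intro exI[of _ e] allI impI)
    fix f g :: "nat \<rightharpoonup> nat" and d s r x
    assume "g d = Some s" "f s = Some r" "g r = Some x"
    then show "seq_comp (Phi e) (subT_join f g) d = Some x"
      unfolding seq_comp_def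
      by (simp add: run.simps[of _ _ "[d]"] run.simps[of _ _ "[d, s]"] run.simps[of _ _ "[d, s, r]"]
          run.simps[of _ _ "[d, s, r, x]"] 1 2 3 4 subT_join_def)
  qed
qed

section \<open>The degrees that violate modularity\<close>

lemma subT_equiv_refl: "(f, f) \<in> subT_equiv"
  by (simp add: subT_equiv_def subT_leI)

theorem theorem4p10:
  "\<exists>a\<in>subT_degrees. \<exists>b\<in>subT_degrees. \<exists>c\<in>subT_degrees.
     degree_le a b \<and>
     degree_join a (degree_meet b c) \<noteq> degree_meet b (degree_join a c)"
proof -
  obtain i where i: "\<And>g. seq_comp (Phi i) g = g" using identity_program by blast
  obtain j where j: "\<And>f g d s r x. g d = Some s \<Longrightarrow> f s = Some r \<Longrightarrow> g r = Some x \<Longrightarrow>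
      seq_comp (Phi j) (subT_join f g) d = Some x"
    using alternating_program by blast
  \<comment> \<open>Requirements are countable, so \<open>from_nat\<close> enumerates all of
    them.\<close>
  define R :: "nat \<Rightarrow> req" where "R = from_nat"
  obtain b c where link: "\<And>d x. odd d \<Longrightarrow> b d = Some x \<Longrightarrow>
       \<exists>s r. even s \<and> c d = Some s \<and> b s = Some r \<and> c r = Some x"
    and diag: "\<And>n. \<exists>d x. odd d \<and> b d = Some x \<and> candidate (R n) b c d \<noteq> Some x"
    using exists_diagonal_pair[of R] by blast
  let ?a = "even_part b"
  let ?A = "subT_equiv `` {?a}" and ?B = "subT_equiv `` {b}" and ?C = "subT_equiv `` {c}"
  let ?X = "subT_meet b (subT_join ?a c)"
  \<comment> \<open>Index \<open>i\<close> reads \<open>x\<close> from \<open>b\<close>, and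
    \<open>j\<close> finds it along the block; since both sides agree, the meet returns
    \<open>x\<close>.\<close>
  have X: "?X (prod_encode (i, prod_encode (j, d))) = Some x" if d: "odd d" "b d = Some x" for d x
  proof -
    obtain s r where "even s" "c d = Some s" "b s = Some r" "c r = Some x"
      using link[OF d] by blast
    then have "seq_comp (Phi j) (subT_join ?a c) d = Some x"
      by (intro j) (auto simp: even_part_def)
    with d show ?thesis by (simp add: subT_meet_def i)
  qed
  have "degree_le ?A ?B"
    unfolding degree_le_def
  proof (intro bexI)
    show "?a \<le>\<^sub>s\<^sub>u\<^sub>b\<^sub>T b" by (intro subT_leI map_leI) (auto simp: even_part_def split: if_splits)
  qed (auto intro: subT_equiv_refl)
  moreover have "?X \<in> degree_meet ?B (degree_join ?A ?C)"
    unfolding degree_meet_def degree_join_def by (blast intro: subT_equiv_refl)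
  \<comment> \<open>The two degrees are separated as sets by the element \<open>?X\<close>.\<close>
  moreover have "?X \<notin> degree_join ?A (degree_meet ?B ?C)"
  proof
    assume "?X \<in> degree_join ?A (degree_meet ?B ?C)"
    then obtain f k f' g' where "(?a, f) \<in> subT_equiv" "(b, f') \<in> subT_equiv" "(c, g') \<in> subT_equiv"
        "(subT_meet f' g', k) \<in> subT_equiv" "(subT_join f k, ?X) \<in> subT_equiv"
      unfolding degree_meet_def degree_join_def by blast
    \<comment> \<open>Each index expresses an arbitrary representative through the chosen functions.
      By monotonicity, \<open>candidate\<close> then bounds the assumed reduction of
      \<open>?X\<close> on the arguments coding \<open>i\<close>, \<open>j\<close> and
      \<open>d\<close>.\<close>
    then obtain e\<^sub>0 e\<^sub>1 e\<^sub>2 e\<^sub>3 e\<^sub>4 where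
      le: "?X \<subseteq>\<^sub>m seq_comp (Phi e\<^sub>0) (subT_join f k)" "f \<subseteq>\<^sub>m seq_comp (Phi e\<^sub>1) ?a"
        "k \<subseteq>\<^sub>m seq_comp (Phi e\<^sub>2) (subT_meet f' g')" "f' \<subseteq>\<^sub>m seq_comp (Phi e\<^sub>3) b"
        "g' \<subseteq>\<^sub>m seq_comp (Phi e\<^sub>4) c"
      by (auto simp: subT_equiv_def subT_le_def)
    let ?r = "(i, j, e\<^sub>0, e\<^sub>1, e\<^sub>2, e\<^sub>3, e\<^sub>4)"
    obtain n where "R n = ?r" unfolding R_def by (metis from_nat_to_nat)
    with diag[of n] obtain d x where d: "odd d" "b d = Some x" "candidate ?r b c d \<noteq> Some x" by auto
    have "k \<subseteq>\<^sub>m seq_comp (Phi e\<^sub>2) (subT_meet (inner_b ?r b) (inner_c ?r c))"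
      using le(4,5) by (intro map_le_trans[OF le(3)] seq_comp_mono subT_meet_mono)
        (simp_all add: inner_b_def inner_c_def)
    then have "?X \<subseteq>\<^sub>m seq_comp (Phi e\<^sub>0) (subT_join (seq_comp (Phi e\<^sub>1) ?a)
        (seq_comp (Phi e\<^sub>2) (subT_meet (inner_b ?r b) (inner_c ?r c))))"
      using le(2) by (intro map_le_trans[OF le(1)] seq_comp_mono subT_join_mono)
    from map_le_Some[OF this X[OF d(1,2)]] have "candidate ?r b c d = Some x"
      by (simp add: candidate_def outer_def)
    with d(3) show False by contradiction
  qed
  ultimately show ?thesis
    unfolding subT_degrees_def by (metis UNIV_I quotientI)
qed

end
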